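(* Let $\alpha,\beta$ be positive integers with $\gcd(\alpha,\beta)=1$, $\alpha$ even, and $\alpha<\beta$. Then: (i) there is at least one $M\in\mathcal{M}$ with $\angle M(e^{j\frac{\alpha}{\beta}\pi})=\frac{\pi}{2}\left(1-\frac{2}{\beta}\right)$; (ii) for each choice of sign $\pm$, there is at least one $M\in\mathcal{M}_{\text{odd}}$ with $\angle M(e^{j\frac{\alpha}{\beta}\pi})=\pm\frac{\pi}{2}\left(1-\frac{1}{\beta}\right)$.
   Context: $j$ is the imaginary unit and $\angle w\in(-\pi,\pi]$ is the argument of a nonzero complex number $w$ (in particular the value of $M$ at the stated frequency is required to be nonzero). For a real two-sided sequence $h=(h_i)_{i\in\mathbb{Z}}$, $\|h\|_1=\sum_{i\in\mathbb{Z}}|h_i|$. Discrete-time LTI Zames-Falb multipliers: $\mathcal{M}$ is the set of functions on the unit circle of the form $M(e^{j\omega})=1-H(e^{j\omega})$, $H(e^{j\omega})=\sum_{i\in\mathbb{Z}}h_ie^{-j\omega i}$, where $h$ is a real sequence with $h_0=0$, $h_i\ge 0$ for all $i$ and $\|h\|_1\le 1$. $\mathcal{M}_{\text{odd}}$ is the set of such functions where $h$ is a real sequence with $h_0=0$ and $\|h\|_1\le 1$ (no sign condition). *)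

theory Defs
  imports "HOL-Analysis.Analysis"
begin

definition l1_norm_le_1 :: "(int \<Rightarrow> real) \<Rightarrow> bool" where
  "l1_norm_le_1 h \<longleftrightarrow>
     (\<lambda>i. \<bar>h i\<bar>) summable_on UNIV \<and> (\<Sum>\<^sub>\<infinity>i\<in>UNIV. \<bar>h i\<bar>) \<le> 1"

definition freq_resp :: "(int \<Rightarrow> real) \<Rightarrow> real \<Rightarrow> complex" where
  "freq_resp h \<omega> =
     (\<Sum>\<^sub>\<infinity>i\<in>UNIV. complex_of_real (h i) * exp (- (\<i> * complex_of_real \<omega> * of_int i)))"

text \<open>Functions on the unit circle are represented by total functions that are extensional,
  i.e. equal to \<^term>\<open>undefined\<close> off the circle.\<close>

definition ZF :: "(complex \<Rightarrow> complex) set" where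
  "ZF = {M \<in> extensional (sphere 0 1). \<exists>h. h 0 = 0 \<and> (\<forall>i. h i \<ge> 0) \<and> l1_norm_le_1 h \<and>
     (\<forall>\<omega>::real. M (exp (\<i> * complex_of_real \<omega>)) = 1 - freq_resp h \<omega>)}"

definition ZF_odd :: "(complex \<Rightarrow> complex) set" where
  "ZF_odd = {M \<in> extensional (sphere 0 1). \<exists>h. h 0 = 0 \<and> l1_norm_le_1 h \<and>
     (\<forall>\<omega>::real. M (exp (\<i> * complex_of_real \<omega>)) = 1 - freq_resp h \<omega>)}"

end

theory Submission
  imports Defs
begin

text \<open>
  Multipliers with a single nonzero tap suffice. As \<open>\<beta>\<close> is odd and coprime to the even \<open>\<alpha>\<close>,
  Bezout yields \<open>\<alpha> k = 1 + \<beta> m\<close> with \<open>m\<close> necessarily odd, so at \<open>\<omega> = \<alpha>\<pi>/\<beta>\<close> the delay by \<open>k\<close>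
  is \<open>-exp (-\<i>\<pi>/\<beta>)\<close> and the delay by \<open>2k\<close> is \<open>exp (-2\<i>\<pi>/\<beta>)\<close>. The claims then follow from
  the fact that \<open>1 - exp (-\<i>\<theta>)\<close> has argument \<open>(\<pi> - \<theta>)/2\<close> for \<open>0 < \<theta> < 2\<pi>\<close>.
\<close>

text \<open>Pulling out the half angle, \<open>1 - cis (- \<theta>) = cis (- \<theta> / 2) * (cis
  (\<theta> / 2) - cis (- \<theta> / 2))\<close>; the bracket is 2i sin(\<theta>/2), and its factor
  i turns the phase by pi/2. This is a polar form wherever the sine is positive.\<close>

lemma one_minus_cis_eq:
  "1 - cis (- \<theta>) = complex_of_real (2 * sin (\<theta> / 2)) * cis ((pi - \<theta>) / 2)"
proof (rule complex_eqI)
  have "cos \<theta> = 1 - 2 * (sin (\<theta> / 2))\<^sup>2"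
    using cos_double_sin[of "\<theta> / 2"] by simp
  moreover have "cos ((pi - \<theta>) / 2) = sin (\<theta> / 2)"
    by (simp add: sin_cos_eq diff_divide_distrib)
  ultimately show "Re (1 - cis (- \<theta>)) =
      Re (complex_of_real (2 * sin (\<theta> / 2)) * cis ((pi - \<theta>) / 2))"
    by (simp add: power2_eq_square)
  have "sin \<theta> = 2 * sin (\<theta> / 2) * cos (\<theta> / 2)"
    using sin_double[of "\<theta> / 2"] by simp
  moreover have "sin ((pi - \<theta>) / 2) = cos (\<theta> / 2)"
    by (simp add: cos_sin_eq diff_divide_distrib)
  ultimately show "Im (1 - cis (- \<theta>)) =
      Im (complex_of_real (2 * sin (\<theta> / 2)) * cis ((pi - \<theta>) / 2))"
    by simp
qed

text \<open>For s = 1 the argument is read off the polar form, whose modulus is positive because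
  \<theta>/2 lies strictly between 0 and pi. The case s = -1 is its complex conjugate.\<close>

lemma Arg_one_minus_cis:
  assumes "0 < \<theta>" "\<theta> < 2 * pi" "s \<in> {1, -1 :: real}"
  shows "1 - cis (- (s * \<theta>)) \<noteq> 0" "Arg (1 - cis (- (s * \<theta>))) = s * ((pi - \<theta>) / 2)"
proof -
  have pos: "2 * sin (\<theta> / 2) > 0"
    using assms by (auto intro: sin_gt_zero)
  have "1 - cis \<theta> = cnj (1 - cis (- \<theta>))"
    by (simp add: cis_cnj)
  also have "\<dots> = complex_of_real (2 * sin (\<theta> / 2)) * cis (- ((pi - \<theta>) / 2))"
    unfolding one_minus_cis_eq by (simp add: cis_cnj)
  finally have eq: "1 - cis (- (s * \<theta>)) =
      complex_of_real (2 * sin (\<theta> / 2)) * cis (s * ((pi - \<theta>) / 2))"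
    using assms(3) one_minus_cis_eq[of \<theta>] by (auto simp: minus_divide_left)
  show "1 - cis (- (s * \<theta>)) \<noteq> 0"
    unfolding eq using pos by simp
  have "Arg (1 - cis (- (s * \<theta>))) = Arg (cis (s * ((pi - \<theta>) / 2)))"
    unfolding eq using pos by (rule Arg_times_of_real)
  \<comment> \<open>The angle lies strictly between -pi/2 and pi/2, so it is the principal
    value.\<close>
  also have "\<dots> = s * ((pi - \<theta>) / 2)"
    using assms by (intro Arg_cis) auto
  finally show "Arg (1 - cis (- (s * \<theta>))) = s * ((pi - \<theta>) / 2)" .
qed

definition tap :: "int \<Rightarrow> real \<Rightarrow> int \<Rightarrow> real" where
  "tap k c i = (if i = k then c else 0)"

text \<open>On the circle \<open>z powi (- k)\<close> is the delay by k. Writing it in z avoids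
  choosing a frequency for each point, and restricting gives the extensionality that
  \<open>ZF\<close> and \<open>ZF_odd\<close> demand.\<close>

definition tap_multiplier :: "int \<Rightarrow> real \<Rightarrow> complex \<Rightarrow> complex" where
  "tap_multiplier k c = restrict (\<lambda>z. 1 - of_real c * z powi (- k)) (sphere 0 1)"

lemma l1_norm_le_1_tap:
  assumes "\<bar>c\<bar> \<le> 1"
  shows "l1_norm_le_1 (tap k c)"
proof -
  have "((\<lambda>i. \<bar>tap k c i\<bar>) has_sum \<bar>c\<bar>) UNIV"
    by (rule has_sum_finite_neutralI[where B = "{k}"]) (auto simp: tap_def)
  then show ?thesis
    using assms by (auto simp: l1_norm_le_1_def has_sum_imp_summable infsumI)
qed

lemma freq_resp_tap: "freq_resp (tap k c) \<omega> = of_real c * cis (- (\<omega> * of_int k))"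
proof -
  have "((\<lambda>i. complex_of_real (tap k c i) * exp (- (\<i> * complex_of_real \<omega> * of_int i)))
      has_sum of_real c * cis (- (\<omega> * of_int k))) UNIV"
    by (rule has_sum_finite_neutralI[where B = "{k}"]) (auto simp: tap_def cis_conv_exp mult_ac)
  then show ?thesis
    unfolding freq_resp_def by (rule infsumI)
qed

lemma tap_multiplier_exp:
  "tap_multiplier k c (exp (\<i> * complex_of_real \<omega>)) = 1 - of_real c * cis (- (\<omega> * of_int k))"
proof -
  have "exp (\<i> * complex_of_real \<omega>) = cis \<omega>"
    by (simp add: cis_conv_exp)
  then show ?thesis
    by (simp add: tap_multiplier_def cis_power_int mult_ac)
qed

lemma tap_multiplier_in_ZF_odd:
  assumes "k \<noteq> 0" "\<bar>c\<bar> \<le> 1"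
  shows "tap_multiplier k c \<in> ZF_odd"
  unfolding ZF_odd_def
proof (intro CollectI conjI exI[of _ "tap k c"] allI)
  show "tap_multiplier k c \<in> extensional (sphere 0 1)"
    by (simp add: tap_multiplier_def)
qed (use assms in \<open>simp_all add: l1_norm_le_1_tap freq_resp_tap tap_multiplier_exp, simp add: tap_def\<close>)

lemma tap_multiplier_in_ZF:
  assumes "k \<noteq> 0" "0 \<le> c" "c \<le> 1"
  shows "tap_multiplier k c \<in> ZF"
  unfolding ZF_def
proof (intro CollectI conjI exI[of _ "tap k c"] allI)
  show "tap_multiplier k c \<in> extensional (sphere 0 1)"
    by (simp add: tap_multiplier_def)
qed (use assms in \<open>simp_all add: l1_norm_le_1_tap freq_resp_tap tap_multiplier_exp, simp_all add: tap_def\<close>)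

lemma cis_minus_odd_pi:
  assumes "odd m"
  shows "cis (x - pi * of_int m) = - cis x"
proof -
  obtain n where m: "m = 2 * n + 1"
    using assms by (elim oddE)
  have "cis (x - pi * of_int m) = cis x * cis (- pi) * cis (2 * pi * of_int (- n))"
    by (simp add: cis_mult m algebra_simps)
  also have "cis (2 * pi * of_int (- n)) = 1"
    by (rule cis_multiple_2pi) simp
  finally show ?thesis
    by (simp add: complex_eq_iff)
qed

theorem theorem6:
  fixes \<alpha> \<beta> :: nat
  assumes "\<alpha> > 0" and "\<beta> > 0" and "gcd \<alpha> \<beta> = 1" and "even \<alpha>" and "\<alpha> < \<beta>"
  shows "(\<exists>M\<in>ZF. M (exp (\<i> * complex_of_real (real \<alpha> / real \<beta> * pi))) \<noteq> 0 \<and>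
            Arg (M (exp (\<i> * complex_of_real (real \<alpha> / real \<beta> * pi)))) = pi / 2 * (1 - 2 / real \<beta>)) \<and>
         (\<forall>s\<in>{1, -1 :: real}.
            \<exists>M\<in>ZF_odd. M (exp (\<i> * complex_of_real (real \<alpha> / real \<beta> * pi))) \<noteq> 0 \<and>
              Arg (M (exp (\<i> * complex_of_real (real \<alpha> / real \<beta> * pi)))) = s * (pi / 2 * (1 - 1 / real \<beta>)))"
proof -
  define \<omega> where "\<omega> = real \<alpha> / real \<beta> * pi"
  have \<beta>: "real \<beta> \<ge> 2"
    using assms by simp
  obtain k n where bezout: "int \<alpha> * k + int \<beta> * n = 1"
    using bezout_int[of "int \<alpha>" "int \<beta>"] assms(3)
    by (metis gcd_int_int_eq mult.commute of_nat_1)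
  define m where "m = - n"
  have km: "int \<alpha> * k = 1 + int \<beta> * m"
    using bezout by (simp add: m_def)
  have "odd m"
  proof
    assume "even m"
    then have "odd (1 + int \<beta> * m)" by simp
    with km assms(4) show False by (metis even_mult_iff even_of_nat)
  qed
  \<comment> \<open>The tap must avoid index 0, where h has to vanish. Here 0 < \<alpha> < \<beta>
    enters: it forces \<beta> > 1, so \<beta> cannot divide 1.\<close>
  have "k \<noteq> 0"
  proof
    assume "k = 0"
    then have "int \<beta> dvd 1"
      using bezout by (metis add_0 dvd_triv_left mult_zero_right)
    then show False
      using assms by simp
  qed
  \<comment> \<open>Since k inverts \<alpha> modulo \<beta>, delaying by k reduces the phase to
    pi/\<beta>, up to a multiple of pi.\<close>
  have \<omega>k: "\<omega> * of_int k = pi / real \<beta> + pi * of_int m"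
  proof -
    have "real \<alpha> * of_int k = 1 + real \<beta> * of_int m"
      using arg_cong[OF km, of real_of_int] by simp
    then have "real \<alpha> * of_int k * pi = (1 + real \<beta> * of_int m) * pi"
      by simp
    then show ?thesis
      using assms by (simp add: \<omega>_def field_simps)
  qed
  \<comment> \<open>Doubling the delay turns the excess pi m into a full multiple of 2 pi, so the
    nonnegative weight 1 works, at the price of 2 pi/\<beta> in place of pi/\<beta>.\<close>
  have "tap_multiplier (2 * k) 1 (exp (\<i> * complex_of_real \<omega>)) = 1 - cis (- (2 * pi / real \<beta>))"
  proof -
    have "\<omega> * of_int (2 * k) = 2 * (\<omega> * of_int k)"
      by simp
    then have "cis (- (\<omega> * of_int (2 * k))) = cis (- (2 * pi / real \<beta>)) * cis (2 * pi * of_int (- m))"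
      unfolding \<omega>k by (simp add: cis_mult algebra_simps)
    also have "cis (2 * pi * of_int (- m)) = 1"
      by (rule cis_multiple_2pi) simp
    finally show ?thesis
      by (simp add: tap_multiplier_exp)
  qed
  moreover have "0 < 2 * pi / real \<beta>" "2 * pi / real \<beta> < 2 * pi"
    using \<beta> by (auto simp: field_simps)
  moreover have "(pi - 2 * pi / real \<beta>) / 2 = pi / 2 * (1 - 2 / real \<beta>)"
    by (simp add: field_simps)
  ultimately have "tap_multiplier (2 * k) 1 (exp (\<i> * complex_of_real \<omega>)) \<noteq> 0 \<and>
      Arg (tap_multiplier (2 * k) 1 (exp (\<i> * complex_of_real \<omega>))) = pi / 2 * (1 - 2 / real \<beta>)"
    using Arg_one_minus_cis[of "2 * pi / real \<beta>" 1] by simp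
  moreover have "tap_multiplier (2 * k) 1 \<in> ZF"
    using \<open>k \<noteq> 0\<close> by (intro tap_multiplier_in_ZF) auto
  moreover have "\<exists>M\<in>ZF_odd. M (exp (\<i> * complex_of_real \<omega>)) \<noteq> 0 \<and>
      Arg (M (exp (\<i> * complex_of_real \<omega>))) = s * (pi / 2 * (1 - 1 / real \<beta>))"
    if s: "s \<in> {1, -1 :: real}" for s
  proof -
    \<comment> \<open>The sign is needed as an integer in order to place the tap at
      \<open>t * k\<close>: reflecting the tap in time conjugates the response and so negates the
      argument.\<close>
    obtain t :: int where t: "s = of_int t" "t \<noteq> 0" "odd t"
      using s by (metis empty_iff insert_iff of_int_1 of_int_minus odd_one
          even_minus one_neq_zero neg_equal_0_iff_equal)
    have "- (\<omega> * of_int (t * k)) = - (s * (pi / real \<beta>)) - pi * of_int (t * m)"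
    proof -
      have "\<omega> * of_int (t * k) = s * (\<omega> * of_int k)"
        by (simp add: t(1))
      then show ?thesis
        unfolding \<omega>k by (simp add: t(1) algebra_simps)
    qed
    moreover have "odd (t * m)"
      using t \<open>odd m\<close> by simp
    \<comment> \<open>The odd multiple of pi flips the sign of the delay, and the weight -1,
      admissible in \<open>ZF_odd\<close>, flips it back.\<close>
    ultimately have "tap_multiplier (t * k) (- 1) (exp (\<i> * complex_of_real \<omega>)) =
        1 - cis (- (s * (pi / real \<beta>)))"
      by (simp add: tap_multiplier_exp cis_minus_odd_pi del: of_int_mult)
    moreover have "0 < pi / real \<beta>" "pi / real \<beta> < 2 * pi"
      using \<beta> by (auto simp: field_simps)
    moreover have "(pi - pi / real \<beta>) / 2 = pi / 2 * (1 - 1 / real \<beta>)"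
      by (simp add: field_simps)
    moreover have "tap_multiplier (t * k) (- 1) \<in> ZF_odd"
      using \<open>k \<noteq> 0\<close> t by (intro tap_multiplier_in_ZF_odd) auto
    ultimately show ?thesis
      using Arg_one_minus_cis[of "pi / real \<beta>" s] s by metis
  qed
  ultimately show ?thesis
    unfolding \<omega>_def by blast
qed

end
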